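(* Let $g:\mathbf{R}^n\to[0,\infty)$ be defined by $g(x)=g(x_1,\dots,x_n)=e^{-(x_1+\dots+x_n)}$ if $x_i\ge 0$ for all $i=1,\dots,n$, and $g(x)=0$ otherwise. Then $$\Delta g(z)=\Delta g(z_1,\dots,z_n)=e^{-(|z_1|+\dots+|z_n|)}\quad\text{for all } z\in\mathbf{R}^n,$$ and $$\int_{\mathbf{R}^n}\Delta g(z)\,dz=2^n\int_{\mathbf{R}^n}g(x)\,dx .$$
   Context: The difference function of a nonnegative function $f$ defined in $\mathbf{R}^n$ is $$\Delta f(z)=\sup\left\{\sqrt{f(x)f(-y)}\;:\;x,y\in\mathbf{R}^n,\ \tfrac12(x+y)=z\right\},\quad z\in\mathbf{R}^n.$$ *)

theory Defs
  imports "HOL-Analysis.Analysis"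
begin

text \<open>The supremum of a nonnegative function need not be finite, so it is taken in
  \<^typ>\<open>ennreal\<close>. The definition is meant for nonnegative \<open>f\<close>.\<close>

definition difference_function :: "(real ^ 'n \<Rightarrow> real) \<Rightarrow> real ^ 'n \<Rightarrow> ennreal"
  where "difference_function f z =
    Sup {ennreal (sqrt (f x * f (- y))) | x y. (1 / 2) *\<^sub>R (x + y) = z}"

end

theory Submission
  imports Defs
begin

text \<open>If \<open>x\<close> and \<open>-y\<close> lie in the positive orthant and \<open>x + y = 2z\<close>, then
  \<open>\<surd>(g(x) g(-y))\<close> is the exponential of minus half the sum of \<open>x\<^sub>i - y\<^sub>i = \<bar>x\<^sub>i\<bar> + \<bar>y\<^sub>i\<bar> \<ge> 2\<bar>z\<^sub>i\<bar>\<close>,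
  with equality when \<open>x\<^sub>i = 2 max(z\<^sub>i, 0)\<close> and \<open>y\<^sub>i = 2 min(z\<^sub>i, 0)\<close>.
  Both integrals factor over the coordinates, and each factor of the first is twice that of the
  second.\<close>

text \<open>The two half-lines meet only in the null set {0}, and reflection gives them equal
  contributions. This is the source of the factor 2 per coordinate.\<close>

lemma nn_integral_abs_eq_double:
  fixes f :: "real \<Rightarrow> ennreal"
  assumes [measurable]: "f \<in> borel_measurable borel"
  shows "(\<integral>\<^sup>+ t. f \<bar>t\<bar> \<partial>lborel) = 2 * (\<integral>\<^sup>+ t. f t * indicator {0..} t \<partial>lborel)"
proof -
  let ?I = "\<integral>\<^sup>+ t. f t * indicator {0..} t \<partial>lborel"
  have "(\<integral>\<^sup>+ t. f \<bar>t\<bar> \<partial>lborel)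
      = (\<integral>\<^sup>+ t. f t * indicator {0..} t + f (- t) * indicator {0..} (- t) \<partial>lborel)"
  proof (rule nn_integral_cong_AE)
    \<comment> \<open>At t = 0 both indicators equal 1 and the right side counts \<open>f 0\<close>
      twice, so the identity is claimed only almost everywhere.\<close>
    show "AE t in lborel. f \<bar>t\<bar> = f t * indicator {0..} t + f (- t) * indicator {0..} (- t)"
      using AE_lborel_singleton[of "0::real"]
      by eventually_elim (auto simp: indicator_def)
  qed
  also have "\<dots> = ?I + (\<integral>\<^sup>+ t. f (- t) * indicator {0..} (- t) \<partial>lborel)"
    by (rule nn_integral_add) measurable
  also have "(\<integral>\<^sup>+ t. f (- t) * indicator {0..} (- t) \<partial>lborel) = ?I"
    using nn_integral_real_affine[of "\<lambda>t. f t * indicator {0..} t" "-1" 0] by simp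
  finally show ?thesis
    by (simp add: mult_2)
qed

text \<open>Tonelli for the product structure of \<open>lborel\<close> over \<open>Basis\<close>;
  the basis vectors are reindexed by coordinates through \<open>axis i 1\<close>.\<close>

lemma nn_integral_lborel_vec_prod:
  fixes f :: "real \<Rightarrow> ennreal"
  assumes "f \<in> borel_measurable borel"
  shows "(\<integral>\<^sup>+ (x::real^'n). (\<Prod>i\<in>UNIV. f (x $ i)) \<partial>lborel) = (\<integral>\<^sup>+ t. f t \<partial>lborel) ^ CARD('n)"
proof -
  have "(\<Prod>b\<in>Basis. f (x \<bullet> b)) = (\<Prod>i\<in>UNIV. f (x $ i))" for x :: "real^'n"
  proof -
    have "bij_betw (\<lambda>i. axis i 1) UNIV (Basis :: (real^'n) set)"
      by (auto simp: bij_betw_def inj_on_def axis_eq_axis Basis_vec_def)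
    from prod.reindex_bij_betw[OF this, of "\<lambda>b. f (x \<bullet> b)"] show ?thesis
      by (simp add: inner_axis)
  qed
  then show ?thesis
    using nn_integral_lborel_prod[of "\<lambda>b::real^'n. f"] assms by simp
qed

lemma difference_function_exp_orthant:
  fixes g :: "real ^ 'n \<Rightarrow> real"
  assumes g: "\<And>x. g x = (if \<forall>i. x $ i \<ge> 0 then exp (- (\<Sum>i\<in>UNIV. x $ i)) else 0)"
  shows "difference_function g z = ennreal (exp (- (\<Sum>i\<in>UNIV. \<bar>z $ i\<bar>)))"
  unfolding difference_function_def
proof (rule antisym)
  \<comment> \<open>The halving stays inside the sum so that exponents can be compared coordinate by
    coordinate.\<close>
  have sqrt_g: "sqrt (g x * g (- y)) = exp (- (\<Sum>i\<in>UNIV. (x $ i - y $ i) / 2))"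
    if "\<forall>i. x $ i \<ge> 0" "\<forall>i. y $ i \<le> 0" for x y
  proof (rule real_sqrt_unique)
    show "(exp (- (\<Sum>i\<in>UNIV. (x $ i - y $ i) / 2)))\<^sup>2 = g x * g (- y)"
      using that
      by (simp add: g flip: exp_double exp_add sum_divide_distrib)
         (simp add: sum_negf sum_subtractf)
  qed simp
  show "Sup {ennreal (sqrt (g x * g (- y))) | x y. (1 / 2) *\<^sub>R (x + y) = z}
      \<le> ennreal (exp (- (\<Sum>i\<in>UNIV. \<bar>z $ i\<bar>)))"
  proof (rule Sup_least, clarify)
    fix x y :: "real^'n"
    let ?z = "(1 / 2) *\<^sub>R (x + y)"
    show "ennreal (sqrt (g x * g (- y))) \<le> ennreal (exp (- (\<Sum>i\<in>UNIV. \<bar>?z $ i\<bar>)))"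
    proof (cases "(\<forall>i. x $ i \<ge> 0) \<and> (\<forall>i. y $ i \<le> 0)")
      case True
      then have "\<bar>?z $ i\<bar> \<le> (x $ i - y $ i) / 2" for i
        by (auto simp: abs_le_iff field_simps dest!: spec[of _ i])
      then show ?thesis
        using True by (auto simp: sqrt_g intro!: ennreal_leI sum_mono)
    next
      case False
      \<comment> \<open>Either x or -y leaves the orthant, so one factor vanishes and the pair
        contributes 0 to the supremum.\<close>
      then have "g x * g (- y) = 0"
        by (auto simp: g)
      then show ?thesis
        by auto
    qed
  qed
  define x y :: "real^'n" where "x = (\<chi> i. 2 * max (z $ i) 0)" and "y = (\<chi> i. 2 * min (z $ i) 0)"
  have "(1 / 2) *\<^sub>R (x + y) = z"
    by (auto simp: x_def y_def vec_eq_iff max_def min_def)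
  moreover have "sqrt (g x * g (- y)) = exp (- (\<Sum>i\<in>UNIV. \<bar>z $ i\<bar>))"
    by (subst sqrt_g) (auto simp: x_def y_def intro!: sum.cong)
  ultimately show "ennreal (exp (- (\<Sum>i\<in>UNIV. \<bar>z $ i\<bar>)))
      \<le> Sup {ennreal (sqrt (g x * g (- y))) | x y. (1 / 2) *\<^sub>R (x + y) = z}"
    by (intro Sup_upper CollectI exI[of _ x] exI[of _ y]) simp
qed

theorem theorem1p2:
  fixes g :: "real ^ 'n \<Rightarrow> real"
  assumes g: "\<And>x. g x = (if \<forall>i. x $ i \<ge> 0 then exp (- (\<Sum>i\<in>UNIV. x $ i)) else 0)"
  shows "(\<forall>z. difference_function g z = ennreal (exp (- (\<Sum>i\<in>UNIV. \<bar>z $ i\<bar>)))) \<and>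
    (\<integral>\<^sup>+ z. difference_function g z \<partial>lborel) = 2 ^ CARD('n) * (\<integral>\<^sup>+ x. ennreal (g x) \<partial>lborel)"
proof -
  \<comment> \<open>One factor without cutoff serves both integrands: composed with the absolute
    value it yields the difference function, cut off by an indicator it yields
    \<open>g\<close>.\<close>
  define f :: "real \<Rightarrow> ennreal" where "f t = ennreal (exp (- t))" for t
  have f [measurable]: "f \<in> borel_measurable borel"
    unfolding f_def by measurable
  note \<Delta>g = difference_function_exp_orthant[OF g]
  \<comment> \<open>A single negative coordinate makes its indicator, and hence the product, zero;
    this reproduces the case distinction in \<open>g\<close>.\<close>
  have prod_g: "(\<Prod>i\<in>UNIV. f (x $ i) * indicator {0..} (x $ i)) = ennreal (g x)" for x :: "real^'n"
  proof (cases "\<forall>i. x $ i \<ge> 0")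
    case True
    then show ?thesis
      by (simp add: g f_def prod_ennreal exp_sum flip: sum_negf)
  next
    case False
    then show ?thesis
      by (auto simp: g indicator_def)
  qed
  have "difference_function g z = (\<Prod>i\<in>UNIV. f \<bar>z $ i\<bar>)" for z
    by (simp add: \<Delta>g f_def prod_ennreal exp_sum flip: sum_negf)
  then have "(\<integral>\<^sup>+ z. difference_function g z \<partial>lborel) = (\<integral>\<^sup>+ t. f \<bar>t\<bar> \<partial>lborel) ^ CARD('n)"
    using nn_integral_lborel_vec_prod[of "\<lambda>t. f \<bar>t\<bar>"] by simp
  also have "\<dots> = 2 ^ CARD('n) * (\<integral>\<^sup>+ t. f t * indicator {0..} t \<partial>lborel) ^ CARD('n)"
    by (simp add: nn_integral_abs_eq_double power_mult_distrib)
  also have "(\<integral>\<^sup>+ t. f t * indicator {0..} t \<partial>lborel) ^ CARD('n)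
      = (\<integral>\<^sup>+ (x::real^'n). (\<Prod>i\<in>UNIV. f (x $ i) * indicator {0..} (x $ i)) \<partial>lborel)"
    using nn_integral_lborel_vec_prod[where 'n = 'n and f = "\<lambda>t. f t * indicator {0..} t"] by simp
  finally show ?thesis
    using \<Delta>g prod_g by simp
qed

end
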